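(* Let $A$ and $B$ be nonempty compact ambiguity sets with $\delta:=D_{\rm op}(A,B)>0$. For every $\xi\in(0,\delta)$ there is a bounded two-action three-date system with a unique pure SPE and an endpoint-collapsed counterpart such that, for one common reward system, $$\mathrm{PoR}_0\ge g>\frac{\delta-\xi}{2},\qquad \mathrm{PoR}_0^{\rm end}=0 .$$ Both the initial-vintage action gap and the off-diagonal self's action gap equal $g$. More generally, apply a coupled perturbation to the payoffs and to evaluators $A$ and $B$, and define the perturbed endpoint surrogate by replacing the perturbed off-diagonal evaluator by the perturbed endpoint evaluator. Suppose each of the two robust action values under either evaluator moves by at most $\omega$. If $2\omega<g$, the two strict choices persist, the endpoint surrogate remains decision equivalent across vintages, and $$\mathrm{PoR}_0-\mathrm{PoR}_0^{\rm end}\ge g-2\omega>0 .$$ In particular, if each payoff vector changes by at most $\varepsilon$ in sup norm and the corresponding ambiguity sets change by at most $\kappa$ in $D_{\rm op}$, then one may take $\omega\le\varepsilon+\kappa$. Endpoint insufficiency therefore holds on a nonempty open set and has a loss floor controlled by the omitted off-diagonal separation.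
   Context: Ambiguity sets and lower expectations. An ambiguity set is a set $E$ of probability vectors in a finite simplex $\Delta_n$. For nonempty compact $E$ and $z\in\mathbb R^n$, $\rho_E(z)=\inf_{p\in E}p^\top z$, and $D_{\rm op}(A,B)=\sup_{\|z\|_\infty\le1}|\rho_A(z)-\rho_B(z)|$. Two sets are decision equivalent if their lower expectations agree on every payoff, i.e. $D_{\rm op}=0$. Systems. A (finite kernel) system is a finite controlled event tree with decision dates $t=0,\dots,T-1$, finite nonempty action sets, finitely many next observations, discount factor $\beta\in(0,1]$, stage rewards $r_t(h_t,a)$, terminal reward $g(h_T)$ (a function, not to be confused with the number $g$ in the claim), and, for $0\le s\le t<T$, nonempty compact sets $\mathcal K_{s,t}(h_t,a)$ of laws of the next observation: the one-step ambiguity used at date $t$ by the evaluator of vintage $s$. "Bounded" means that stage and terminal rewards are bounded; "three-date" means three decision dates ($T=3$); "two-action" means that the choice at issue is between two actions. Values and equilibrium. For a pure policy $\pi$, $V^{\pi}_{s,T}=g$, $Q_t^{s,\pi}(h_t,a)=r_t(h_t,a)+\beta\inf_{q\in\mathcal K_{s,t}(h_t,a)}\sum_yq(y)V^{\pi}_{s,t+1}(h_t,a,y)$ and $V^{\pi}_{s,t}(h_t)=Q_t^{s,\pi}(h_t,\pi_t(h_t))$. A pure SPE is a pure policy with $\pi_t(h_t)\in\arg\max_aQ_t^{t,\pi}(h_t,a)$ at every history. $\mathrm{PoR}_0$ is the maximum over policies of the vintage-$0$ root value minus the vintage-$0$ root value of the SPE; $\mathrm{PoR}_0^{\rm end}$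 is the same quantity for the endpoint-collapsed counterpart. Endpoint and off-diagonal evaluators. The endpoint kernels are $\mathcal K_{0,u}$ and $\mathcal K_{u,u}$ (initial and current vintage); the off-diagonal kernels are $\mathcal K_{s,u}$ with $0<s<u$, and the off-diagonal self is the self of vintage $s$. The sets $A$ and $B$ are used as the system's evaluators, one in the off-diagonal role and the other in the endpoint role. The endpoint-collapsed counterpart (endpoint surrogate) keeps the endpoint kernels and replaces the off-diagonal evaluator by the endpoint evaluator. An evaluator's action gap is the difference between its robust values of its best action and of the other action; the two strict choices are the strictly preferred actions of the initial vintage and of the off-diagonal self. Payoff vectors are the payoffs over outcomes attached to the two actions. Endpoint insufficiency means that the endpoint kernels alone do not determine the Price of Relearning. *)

theory Defs
  imports "HOL-Analysis.Analysis"
begin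

section \<open>Ambiguity sets and lower expectations\<close>

definition prob_simplex :: "(real ^ 'n) set" where
  "prob_simplex = {p. (\<forall>i. 0 \<le> p $ i) \<and> (\<Sum>i\<in>UNIV. p $ i) = 1}"

definition ambiguity_set :: "(real ^ 'n) set \<Rightarrow> bool" where
  "ambiguity_set E \<longleftrightarrow> E \<noteq> {} \<and> compact E \<and> E \<subseteq> prob_simplex"

definition lower_exp :: "(real ^ 'n) set \<Rightarrow> real ^ 'n \<Rightarrow> real" where
  "lower_exp E z = (INF p\<in>E. p \<bullet> z)"

definition D_op :: "(real ^ 'n) set \<Rightarrow> (real ^ 'n) set \<Rightarrow> real" where
  "D_op A B = (SUP z\<in>{z. infnorm z \<le> 1}. \<bar>lower_exp A z - lower_exp B z\<bar>)"

definition decision_equivalent :: "(real ^ 'n) set \<Rightarrow> (real ^ 'n) set \<Rightarrow> bool" where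
  "decision_equivalent A B \<longleftrightarrow> (\<forall>z. lower_exp A z = lower_exp B z)"


section \<open>Finite kernel systems\<close>

text \<open>A history of date t is the list of the t action/observation pairs realised so far,
  oldest first, so its date is its length. Accordingly \<open>ker S s h a\<close> is the one-step ambiguity
  \<open>K\<^sub>s\<^sub>,\<^sub>t(h, a)\<close> with \<open>t = length h\<close>; only \<open>s \<le> length h\<close> is meaningful. Laws of the next
  observation are vectors indexed by the finite observation type that vanish outside
  \<open>obs S h a\<close>.\<close>

type_synonym ('a, 'y) history = "('a \<times> 'y) list"

record ('a, 'y :: finite) kernel_system =
  horizon :: nat
  act :: "('a, 'y) history \<Rightarrow> 'a set"
  obs :: "('a, 'y) history \<Rightarrow> 'a \<Rightarrow> 'y set"
  disc :: real
  rew :: "('a, 'y) history \<Rightarrow> 'a \<Rightarrow> real"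
  trew :: "('a, 'y) history \<Rightarrow> real"
  ker :: "nat \<Rightarrow> ('a, 'y) history \<Rightarrow> 'a \<Rightarrow> (real ^ 'y) set"

primrec hists :: "('a, 'y :: finite) kernel_system \<Rightarrow> nat \<Rightarrow> ('a, 'y) history set" where
  "hists S 0 = {[]}"
| "hists S (Suc t) = {h @ [(a, y)] | h a y. h \<in> hists S t \<and> a \<in> act S h \<and> y \<in> obs S h a}"

definition decision_hists :: "('a, 'y :: finite) kernel_system \<Rightarrow> ('a, 'y) history set" where
  "decision_hists S = (\<Union>t<horizon S. hists S t)"

definition finite_kernel_system :: "('a, 'y :: finite) kernel_system \<Rightarrow> bool" where
  "finite_kernel_system S \<longleftrightarrow>
     0 < disc S \<and> disc S \<le> 1 \<and>
     (\<forall>h\<in>decision_hists S. finite (act S h) \<and> act S h \<noteq> {} \<and>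
        (\<forall>a\<in>act S h. obs S h a \<noteq> {} \<and>
           (\<forall>s\<le>length h. ambiguity_set (ker S s h a) \<and>
              (\<forall>q\<in>ker S s h a. \<forall>y. y \<notin> obs S h a \<longrightarrow> q $ y = 0))))"

definition rewards_bounded_by :: "real \<Rightarrow> ('a, 'y :: finite) kernel_system \<Rightarrow> bool" where
  "rewards_bounded_by M S \<longleftrightarrow>
     (\<forall>h\<in>decision_hists S. \<forall>a\<in>act S h. \<bar>rew S h a\<bar> \<le> M) \<and>
     (\<forall>h\<in>hists S (horizon S). \<bar>trew S h\<bar> \<le> M)"

text \<open>Policies are extensional, i.e. \<open>undefined\<close> off the decision histories, so that uniqueness
  of an equilibrium means uniqueness on the event tree.\<close>

definition policies :: "('a, 'y :: finite) kernel_system \<Rightarrow> (('a, 'y) history \<Rightarrow> 'a) set" where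
  "policies S = (\<Pi>\<^sub>E h\<in>decision_hists S. act S h)"

text \<open>\<open>val S \<pi> s h\<close> is the value at h of the policy \<open>\<pi>\<close> for the evaluator of vintage s. The payoff
  vector ranges over the whole observation type, but laws put no mass outside \<open>obs S h a\<close>.\<close>

function val :: "('a, 'y :: finite) kernel_system \<Rightarrow> (('a, 'y) history \<Rightarrow> 'a) \<Rightarrow> nat \<Rightarrow>
    ('a, 'y) history \<Rightarrow> real" where
  "val S \<pi> s h =
     (if length h < horizon S
      then rew S h (\<pi> h) +
           disc S * lower_exp (ker S s h (\<pi> h)) (\<chi> y. val S \<pi> s (h @ [(\<pi> h, y)]))
      else trew S h)"
  by pat_completeness auto
termination
  by (relation "Wellfounded.measure (\<lambda>(S, \<pi>, s, h). horizon S - length h)") auto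

declare val.simps [simp del]

definition qval :: "('a, 'y :: finite) kernel_system \<Rightarrow> (('a, 'y) history \<Rightarrow> 'a) \<Rightarrow> nat \<Rightarrow>
    ('a, 'y) history \<Rightarrow> 'a \<Rightarrow> real" where
  "qval S \<pi> s h a =
     rew S h a + disc S * lower_exp (ker S s h a) (\<chi> y. val S \<pi> s (h @ [(a, y)]))"

lemma val_eq_qval: "length h < horizon S \<Longrightarrow> val S \<pi> s h = qval S \<pi> s h (\<pi> h)"
  by (subst val.simps) (simp add: qval_def)

lemma val_terminal: "length h = horizon S \<Longrightarrow> val S \<pi> s h = trew S h"
  by (subst val.simps) simp

definition pure_SPE :: "('a, 'y :: finite) kernel_system \<Rightarrow> (('a, 'y) history \<Rightarrow> 'a) \<Rightarrow> bool" where
  "pure_SPE S \<pi> \<longleftrightarrow> \<pi> \<in> policies S \<and>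
     (\<forall>h\<in>decision_hists S. is_arg_max (qval S \<pi> (length h) h) (\<lambda>a. a \<in> act S h) (\<pi> h))"

text \<open>The next two notions are meaningful for systems with exactly one pure SPE.\<close>

definition the_SPE :: "('a, 'y :: finite) kernel_system \<Rightarrow> ('a, 'y) history \<Rightarrow> 'a" where
  "the_SPE S = (THE \<pi>. pure_SPE S \<pi>)"

definition PoR\<^sub>0 :: "('a, 'y :: finite) kernel_system \<Rightarrow> real" where
  "PoR\<^sub>0 S = Max ((\<lambda>\<pi>. val S \<pi> 0 []) ` policies S) - val S (the_SPE S) 0 []"

definition strictly_prefers :: "('a, 'y :: finite) kernel_system \<Rightarrow> (('a, 'y) history \<Rightarrow> 'a) \<Rightarrow> nat \<Rightarrow>
    ('a, 'y) history \<Rightarrow> 'a \<Rightarrow> bool" where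
  "strictly_prefers S \<pi> s h a \<longleftrightarrow>
     a \<in> act S h \<and> (\<forall>b\<in>act S h - {a}. qval S \<pi> s h b < qval S \<pi> s h a)"

text \<open>For two available actions: value of the better one minus value of the other one.\<close>

definition action_gap :: "('a, 'y :: finite) kernel_system \<Rightarrow> (('a, 'y) history \<Rightarrow> 'a) \<Rightarrow> nat \<Rightarrow>
    ('a, 'y) history \<Rightarrow> real" where
  "action_gap S \<pi> s h = Max (qval S \<pi> s h ` act S h) - Min (qval S \<pi> s h ` act S h)"


section \<open>Endpoint data and endpoint collapse\<close>

text \<open>The collapse is applied to systems in which the initial and the current vintage use the
  same evaluator at the dates where off-diagonal kernels exist, so that substituting
  \<open>ker S 0\<close> or \<open>ker S (length h)\<close> is the same.\<close>

definition endpoint_collapse :: "('a, 'y :: finite) kernel_system \<Rightarrow> ('a, 'y) kernel_system" where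
  "endpoint_collapse S =
     S\<lparr>ker := (\<lambda>s h a. if 0 < s \<and> s < length h then ker S 0 h a else ker S s h a)\<rparr>"

definition same_endpoint_data ::
    "('a, 'y :: finite) kernel_system \<Rightarrow> ('a, 'y) kernel_system \<Rightarrow> bool" where
  "same_endpoint_data S S' \<longleftrightarrow>
     horizon S' = horizon S \<and> act S' = act S \<and> obs S' = obs S \<and> disc S' = disc S \<and>
     rew S' = rew S \<and> trew S' = trew S \<and>
     (\<forall>h a. ker S' 0 h a = ker S 0 h a \<and> ker S' (length h) h a = ker S (length h) h a)"

definition endpoint_insufficient :: "('a, 'y :: finite) kernel_system \<Rightarrow> bool" where
  "endpoint_insufficient S \<longleftrightarrow>
     finite_kernel_system S \<and> (\<exists>!\<pi>. pure_SPE S \<pi>) \<and>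
     (\<exists>S'. finite_kernel_system S' \<and> (\<exists>!\<pi>. pure_SPE S' \<pi>) \<and>
           same_endpoint_data S S' \<and> PoR\<^sub>0 S' \<noteq> PoR\<^sub>0 S)"

definition decision_equivalent_across_vintages :: "('a, 'y :: finite) kernel_system \<Rightarrow> bool" where
  "decision_equivalent_across_vintages S \<longleftrightarrow>
     (\<forall>h\<in>decision_hists S. \<forall>a\<in>act S h. \<forall>s\<le>length h. \<forall>s'\<le>length h.
        decision_equivalent (ker S s h a) (ker S s' h a))"


section \<open>Two-action three-date systems\<close>

text \<open>With three decision dates the only off-diagonal kernel is \<open>K\<^sub>1\<^sub>,\<^sub>2\<close>: the off-diagonal self is
  vintage 1, who chooses at date 1 between two actions whose outcome is the observation that
  follows date 2.\<close>

definition two_action_three_date ::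
    "('a, 'y :: finite) kernel_system \<Rightarrow> ('a, 'y) history \<Rightarrow> 'a \<Rightarrow> 'a \<Rightarrow> bool" where
  "two_action_three_date S h a b \<longleftrightarrow>
     horizon S = 3 \<and> h \<in> hists S 1 \<and> a \<noteq> b \<and> act S h = {a, b} \<and>
     (\<forall>h'\<in>decision_hists S. h' \<noteq> h \<longrightarrow> card (act S h') = 1)"

definition uses_evaluators ::
    "('a, 'y :: finite) kernel_system \<Rightarrow> (real ^ 'y) set \<Rightarrow> (real ^ 'y) set \<Rightarrow> bool" where
  "uses_evaluators S Off End \<longleftrightarrow>
     (\<forall>h\<in>hists S 2. \<forall>a\<in>act S h.
        ker S 1 h a = Off \<and> ker S 0 h a = End \<and> ker S 2 h a = End)"

text \<open>\<open>z a\<close> is the payoff vector attached to the date-1 action \<open>a\<close>; its index is the last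
  observation.\<close>

definition has_payoff_vectors ::
    "('a, 'y :: finite) kernel_system \<Rightarrow> ('a \<Rightarrow> real ^ 'y) \<Rightarrow> bool" where
  "has_payoff_vectors S z \<longleftrightarrow>
     (\<forall>h\<in>hists S 3. trew S h = z (fst (h ! 1)) $ snd (h ! 2))"

definition perturb :: "('a, 'y :: finite) kernel_system \<Rightarrow> ('a \<Rightarrow> real ^ 'y) \<Rightarrow>
    (real ^ 'y) set \<Rightarrow> (real ^ 'y) set \<Rightarrow> ('a, 'y) kernel_system" where
  "perturb S z' Off' End' =
     S\<lparr>trew := (\<lambda>h. z' (fst (h ! 1)) $ snd (h ! 2)),
       ker := (\<lambda>s h a. if length h = 2 then (if s = 1 then Off' else End') else ker S s h a)\<rparr>"

text \<open>Openness in the space of triples (payoff vectors, off-diagonal evaluator, endpoint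
  evaluator), for the sup norm on payoff vectors and the pseudometric \<open>D_op\<close> on evaluators.\<close>

definition perturbation_space ::
    "(('a :: finite \<Rightarrow> real ^ 'y) \<times> (real ^ 'y) set \<times> (real ^ 'y) set) set" where
  "perturbation_space = {(z, Off, End). ambiguity_set Off \<and> ambiguity_set End}"

definition perturbation_open ::
    "(('a :: finite \<Rightarrow> real ^ 'y) \<times> (real ^ 'y) set \<times> (real ^ 'y) set) set \<Rightarrow> bool" where
  "perturbation_open U \<longleftrightarrow> U \<subseteq> perturbation_space \<and>
     (\<forall>(z, Off, End)\<in>U. \<exists>r>0. \<forall>(z', Off', End')\<in>perturbation_space.
        (\<forall>a. infnorm (z' a - z a) < r) \<and> D_op Off' Off < r \<and> D_op End' End < r
        \<longrightarrow> (z', Off', End') \<in> U)"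

end

theory Submission imports Defs begin

text \<open>
  A lower expectation turns a constant payoff into that constant, so a sure payoff compares two
  evaluators on a risky payoff \<open>u\<close>: if they value \<open>u\<close> differently and the sure payoff is
  put halfway between the two values, then one evaluator strictly prefers \<open>u\<close>, the other one
  strictly prefers the sure payoff, and both gaps are half the distance of the two values
  (\<open>halfway_payoffs\<close>). A payoff \<open>u\<close> in the unit ball at which this distance exceeds
  \<open>\<delta> - \<xi>\<close> exists because \<open>D_op\<close> is a supremum.

  The disagreement is embedded in a tree whose only real choice is made at date 1, by vintage 1,
  between two actions that are paid after date 2 (\<open>relay\<close>). The kernel that evaluates this
  payment is the off-diagonal one for the self who chooses and the endpoint one for vintage 0.
  So the unique equilibrium follows the off-diagonal preference, while the best policy of vintage 0
  follows the endpoint preference, and the Price of Relearning is exactly the endpoint gap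
  (\<open>PoR_relay_disagree\<close>). Collapsing to the endpoints makes the chooser agree with vintage 0
  and the price vanishes (\<open>PoR_relay_agree\<close>).

  Perturbing and collapsing stay inside this family of trees. A perturbation is therefore
  controlled by the two action values alone: each gap shrinks by at most twice the largest change
  of a value. How far values can move follows from two Lipschitz bounds, with constant 1 in the
  payoff and with constant \<open>infnorm z\<close> in the evaluator; these also give openness.
\<close>

section \<open>Lower expectations\<close>

lemma prob_simplex_inner_le_infnorm:
  fixes p z :: "real ^ 'n"
  assumes "p \<in> prob_simplex"
  shows "\<bar>p \<bullet> z\<bar> \<le> infnorm z"
proof -
  have nonneg: "\<And>i. 0 \<le> p $ i" and mass: "(\<Sum>i\<in>UNIV. p $ i) = 1"
    using assms by (auto simp: prob_simplex_def)
  have "\<bar>p \<bullet> z\<bar> \<le> (\<Sum>i\<in>UNIV. \<bar>p $ i * z $ i\<bar>)"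
    by (simp add: inner_vec_def sum_abs)
  also have "\<dots> \<le> (\<Sum>i\<in>UNIV. p $ i * infnorm z)"
    using nonneg by (intro sum_mono) (simp add: abs_mult mult_left_mono component_le_infnorm_cart)
  also have "\<dots> = infnorm z"
    using mass by (simp flip: sum_distrib_right)
  finally show ?thesis .
qed

lemma lower_exp_le:
  assumes "ambiguity_set E" and "p \<in> E"
  shows "lower_exp E z \<le> p \<bullet> z"
proof -
  have "bdd_below ((\<lambda>p. p \<bullet> z) ` E)"
  proof (rule bdd_belowI2)
    fix q assume "q \<in> E"
    then show "- infnorm z \<le> q \<bullet> z"
      using assms(1) prob_simplex_inner_le_infnorm[of q z] by (auto simp: ambiguity_set_def)
  qed
  then show ?thesis
    unfolding lower_exp_def using assms(2) by (rule cINF_lower)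
qed

lemma le_lower_exp:
  assumes "ambiguity_set E" and "\<And>p. p \<in> E \<Longrightarrow> c \<le> p \<bullet> z"
  shows "c \<le> lower_exp E z"
  using assms unfolding lower_exp_def ambiguity_set_def by (intro cINF_greatest) auto

lemma lower_exp_lipschitz:
  assumes "ambiguity_set E"
  shows "\<bar>lower_exp E z - lower_exp E z'\<bar> \<le> infnorm (z - z')"
proof -
  have "lower_exp E v - infnorm (v - v') \<le> lower_exp E v'" for v v'
  proof (rule le_lower_exp[OF assms])
    fix p assume p: "p \<in> E"
    then have "\<bar>p \<bullet> (v - v')\<bar> \<le> infnorm (v - v')"
      using assms by (intro prob_simplex_inner_le_infnorm) (auto simp: ambiguity_set_def)
    with lower_exp_le[OF assms p, of v] show "lower_exp E v - infnorm (v - v') \<le> p \<bullet> v'"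
      by (simp add: inner_diff_right)
  qed
  from this[of z z'] this[of z' z] show ?thesis
    by (simp add: infnorm_sub abs_le_iff)
qed

lemma lower_exp_zero: "ambiguity_set E \<Longrightarrow> lower_exp E 0 = 0"
  by (simp add: lower_exp_def ambiguity_set_def)

lemma abs_lower_exp_le_infnorm: "ambiguity_set E \<Longrightarrow> \<bar>lower_exp E z\<bar> \<le> infnorm z"
  using lower_exp_lipschitz[of E z 0] by (simp add: lower_exp_zero)

lemma lower_exp_const:
  assumes "ambiguity_set E"
  shows "lower_exp E (\<chi> i. c) = c"
proof -
  have "p \<bullet> (\<chi> i. c) = c" if "p \<in> E" for p
    using that assms
    by (auto simp: ambiguity_set_def prob_simplex_def inner_vec_def simp flip: sum_distrib_right)
  then show ?thesis
    using assms by (simp add: lower_exp_def ambiguity_set_def)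
qed

lemma lower_exp_scaleR:
  assumes E: "ambiguity_set E" and c: "0 < c"
  shows "lower_exp E (c *\<^sub>R z) = c * lower_exp E z"
proof (rule antisym)
  have "lower_exp E (c *\<^sub>R z) / c \<le> lower_exp E z"
    using lower_exp_le[OF E, of _ "c *\<^sub>R z"] c
    by (intro le_lower_exp[OF E]) (simp add: divide_le_eq mult.commute)
  then show "lower_exp E (c *\<^sub>R z) \<le> c * lower_exp E z"
    using c by (simp add: divide_le_eq mult.commute)
  show "c * lower_exp E z \<le> lower_exp E (c *\<^sub>R z)"
    using lower_exp_le[OF E, of _ z] c by (intro le_lower_exp[OF E]) simp
qed

lemma lower_exp_dirac: "lower_exp {axis w 1} z = z $ w"
  by (simp add: lower_exp_def inner_axis')

lemma ambiguity_set_dirac: "ambiguity_set {axis w 1}"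
  by (auto simp: ambiguity_set_def prob_simplex_def axis_def)


section \<open>The operational distance\<close>

lemma bdd_above_D_op:
  assumes "ambiguity_set A" and "ambiguity_set B"
  shows "bdd_above ((\<lambda>z. \<bar>lower_exp A z - lower_exp B z\<bar>) ` {z. infnorm z \<le> 1})"
proof (rule bdd_aboveI2)
  fix z :: "real ^ 'a" assume "z \<in> {z. infnorm z \<le> 1}"
  then show "\<bar>lower_exp A z - lower_exp B z\<bar> \<le> 2"
    using abs_lower_exp_le_infnorm[OF assms(1), of z] abs_lower_exp_le_infnorm[OF assms(2), of z]
    by simp
qed

lemma D_op_commute: "D_op A B = D_op B A"
  by (simp add: D_op_def abs_minus_commute)

lemma D_op_nonneg:
  assumes "ambiguity_set A" and "ambiguity_set B"
  shows "0 \<le> D_op A B"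
  unfolding D_op_def
  by (rule cSUP_upper2[OF bdd_above_D_op[OF assms], of 0]) (simp_all add: infnorm_0)

text \<open>The supremum over the unit ball controls all payoffs, by positive homogeneity.\<close>

lemma lower_exp_diff_le_D_op:
  assumes A: "ambiguity_set A" and B: "ambiguity_set B"
  shows "\<bar>lower_exp A z - lower_exp B z\<bar> \<le> D_op A B * infnorm z"
proof (cases "z = 0")
  case True
  then show ?thesis
    using A B by (simp add: lower_exp_zero infnorm_0)
next
  case False
  define c where "c = infnorm z"
  define v where "v = (1 / c) *\<^sub>R z"
  have c: "0 < c"
    using False by (simp add: c_def infnorm_pos_lt)
  have z: "z = c *\<^sub>R v"
    using c by (simp add: v_def)
  have "infnorm v = 1"
    using c by (simp add: v_def infnorm_mul flip: c_def)
  then have "\<bar>lower_exp A v - lower_exp B v\<bar> \<le> D_op A B"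
    unfolding D_op_def by (intro cSUP_upper bdd_above_D_op A B) simp
  then have "c * \<bar>lower_exp A v - lower_exp B v\<bar> \<le> c * D_op A B"
    using c by simp
  moreover have "\<bar>lower_exp A z - lower_exp B z\<bar> = c * \<bar>lower_exp A v - lower_exp B v\<bar>"
    using c by (simp add: z lower_exp_scaleR A B abs_mult flip: right_diff_distrib)
  ultimately show ?thesis
    by (simp add: c_def mult.commute)
qed

lemma lower_exp_perturbation_le:
  assumes "ambiguity_set E" and "ambiguity_set E'"
  shows "\<bar>lower_exp E' z' - lower_exp E z\<bar> \<le> infnorm (z' - z) + D_op E' E * infnorm z"
  using lower_exp_lipschitz[OF assms(2), of z' z] lower_exp_diff_le_D_op[OF assms(2,1), of z]
  by linarith

text \<open>Halfway between the values that the two evaluators give to a payoff \<open>u\<close> lies a sure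
  payoff \<open>m\<close>. Which of \<open>u\<close> and \<open>m\<close> is the endpoint choice (index \<open>True\<close>) depends on
  the sign of the disagreement, which cannot be chosen: a lower expectation is not odd, so
  replacing \<open>u\<close> by \<open>- u\<close> need not reverse it.\<close>

lemma halfway_payoffs:
  fixes Off End :: "(real ^ 'n) set"
  assumes Off: "ambiguity_set Off" and End: "ambiguity_set End" and less: "d < D_op Off End"
  obtains z :: "bool \<Rightarrow> real ^ 'n" and g where
    "\<And>c. infnorm (z c) \<le> 1" and "d / 2 < g"
    and "lower_exp End (z True) - lower_exp End (z False) = g"
    and "lower_exp Off (z False) - lower_exp Off (z True) = g"
proof -
  obtain u where u: "infnorm u \<le> 1" "d < \<bar>lower_exp Off u - lower_exp End u\<bar>"
  proof -
    have "\<exists>u\<in>{u. infnorm u \<le> 1}. d < \<bar>lower_exp Off u - lower_exp End u\<bar>"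
      using less unfolding D_op_def
      by (subst (asm) less_cSUP_iff[OF _ bdd_above_D_op[OF Off End]])
        (auto intro: exI[of _ 0] simp: infnorm_0)
    then show ?thesis
      using that by auto
  qed
  define m where "m = (lower_exp Off u + lower_exp End u) / 2"
  define sure :: "real ^ 'n" where "sure = (\<chi> i. m)"
  have m: "\<bar>m\<bar> \<le> 1"
    using abs_lower_exp_le_infnorm[OF Off, of u] abs_lower_exp_le_infnorm[OF End, of u] u(1)
    unfolding m_def abs_le_iff by (simp add: field_simps)
  have sure: "lower_exp Off sure = m" "lower_exp End sure = m"
    by (simp_all add: sure_def lower_exp_const Off End)
  have "infnorm sure \<le> 1"
    unfolding infnorm_cart by (rule cSup_least) (use m in \<open>auto simp: sure_def\<close>)
  define z where
    "z c = (if c = (lower_exp Off u < lower_exp End u) then u else sure)" for c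
  show thesis
  proof (rule that[of z "\<bar>lower_exp Off u - lower_exp End u\<bar> / 2"])
    show "infnorm (z c) \<le> 1" for c
      using u(1) \<open>infnorm sure \<le> 1\<close> by (simp add: z_def)
  qed (use u(2) sure in \<open>auto simp: z_def m_def field_simps abs_if\<close>)
qed


section \<open>Trees with a single choice, made by the off-diagonal self\<close>

text \<open>The observation \<open>w\<close> is a placeholder, the only one that can follow the decisions of
  dates 0 and 1, and \<open>True\<close> is the only action at dates 0 and 2. So the only histories of
  dates 1 and 2 are \<open>[(True, w)]\<close> and \<open>[(True, w), (c, w)]\<close>, where \<open>c\<close> is the choice
  made at date 1; the observation after date 2 ranges over all outcomes and pays \<open>z c\<close>.\<close>

definition relay :: "'n \<Rightarrow> (bool \<Rightarrow> real ^ 'n) \<Rightarrow> (real ^ 'n) set \<Rightarrow> (real ^ 'n) set \<Rightarrow>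
    (bool, 'n :: finite) kernel_system" where
  "relay w z Off End =
     \<lparr>horizon = 3,
      act = (\<lambda>h. if h = [(True, w)] then UNIV else {True}),
      obs = (\<lambda>h a. if length h = 2 then UNIV else {w}),
      disc = 1,
      rew = (\<lambda>h a. 0),
      trew = (\<lambda>h. z (fst (h ! 1)) $ snd (h ! 2)),
      ker = (\<lambda>s h a. if length h = 2 then (if s = 1 then Off else End) else {axis w 1})\<rparr>"

lemma relay_sel [simp]:
  "horizon (relay w z Off End) = 3"
  "act (relay w z Off End) h = (if h = [(True, w)] then UNIV else {True})"
  "obs (relay w z Off End) h a = (if length h = 2 then UNIV else {w})"
  "disc (relay w z Off End) = 1"
  "rew (relay w z Off End) h a = 0"
  "trew (relay w z Off End) h = z (fst (h ! 1)) $ snd (h ! 2)"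
  "ker (relay w z Off End) s h a =
     (if length h = 2 then (if s = 1 then Off else End) else {axis w 1})"
  by (simp_all add: relay_def)

text \<open>The family is closed under both operations on systems, so facts about \<open>relay\<close> apply to
  perturbed and collapsed systems as well.\<close>

lemma perturb_relay: "perturb (relay w z Off End) z' Off' End' = relay w z' Off' End'"
  by (simp add: perturb_def relay_def fun_eq_iff)

lemma endpoint_collapse_relay: "endpoint_collapse (relay w z Off End) = relay w z End End"
  by (auto simp: endpoint_collapse_def relay_def fun_eq_iff)

lemma hists_Suc_UN:
  "hists S (Suc t) = (\<Union>h\<in>hists S t. \<Union>a\<in>act S h. (\<lambda>y. h @ [(a, y)]) ` obs S h a)"
  by auto

lemma hists_relay:
  "hists (relay w z Off End) 1 = {[(True, w)]}"
  "hists (relay w z Off End) 2 = {[(True, w), (True, w)], [(True, w), (False, w)]}"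
  "hists (relay w z Off End) 3 = (\<Union>c. range (\<lambda>y. [(True, w), (c, w), (True, y)]))"
proof -
  show 1: "hists (relay w z Off End) 1 = {[(True, w)]}"
    unfolding One_nat_def hists_Suc_UN by simp
  have 2: "hists (relay w z Off End) (Suc 1) = {[(True, w), (True, w)], [(True, w), (False, w)]}"
    unfolding hists_Suc_UN 1 by (simp add: UNIV_bool insert_commute)
  then show "hists (relay w z Off End) 2 = {[(True, w), (True, w)], [(True, w), (False, w)]}"
    by (simp only: Suc_1)
  have "hists (relay w z Off End) (Suc (Suc 1))
      = (\<Union>c. range (\<lambda>y. [(True, w), (c, w), (True, y)]))"
    unfolding hists_Suc_UN[of _ "Suc 1"] 2 by (simp add: UNIV_bool Un_commute)
  then show "hists (relay w z Off End) 3 = (\<Union>c. range (\<lambda>y. [(True, w), (c, w), (True, y)]))"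
    by (simp only: Suc_1 eval_nat_numeral)
qed

lemma decision_hists_relay:
  "decision_hists (relay w z Off End) =
     {[], [(True, w)], [(True, w), (True, w)], [(True, w), (False, w)]}"
proof -
  have "{..<3::nat} = {0, 1, 2}"
    by auto
  then have "decision_hists (relay w z Off End) =
      hists (relay w z Off End) 0 \<union> hists (relay w z Off End) 1 \<union> hists (relay w z Off End) 2"
    by (auto simp: decision_hists_def)
  then show ?thesis
    unfolding hists_relay by auto
qed

lemma finite_kernel_system_relay:
  assumes "ambiguity_set Off" and "ambiguity_set End"
  shows "finite_kernel_system (relay w z Off End)"
  using assms ambiguity_set_dirac[of w]
  by (auto simp: finite_kernel_system_def decision_hists_relay axis_def)

lemma val_relay_date_2:
  "val (relay w z Off End) \<pi> s [(True, w), (c, w)] = lower_exp (if s = 1 then Off else End) (z c)"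
  by (simp add: val.simps)

lemma qval_relay_date_1:
  "qval (relay w z Off End) \<pi> s [(True, w)] c = lower_exp (if s = 1 then Off else End) (z c)"
  by (simp add: qval_def lower_exp_dirac val_relay_date_2)

lemma val_relay_root:
  assumes "\<pi> [] = True"
  shows "val (relay w z Off End) \<pi> 0 [] = lower_exp End (z (\<pi> [(True, w)]))"
  using assms
  by (subst val.simps) (simp add: lower_exp_dirac val_eq_qval qval_relay_date_1)

definition relay_policy :: "'n \<Rightarrow> bool \<Rightarrow> (bool, 'n) history \<Rightarrow> bool" where
  "relay_policy w c =
     (\<lambda>h\<in>{[], [(True, w)], [(True, w), (True, w)], [(True, w), (False, w)]}.
        if h = [(True, w)] then c else True)"

lemma relay_policy_choice [simp]: "relay_policy w c [(True, w)] = c"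
  by (simp add: relay_policy_def)

lemma policies_relay: "policies (relay w z Off End) = {relay_policy w True, relay_policy w False}"
proof (intro equalityI subsetI)
  fix \<pi> assume \<pi>: "\<pi> \<in> policies (relay w z Off End)"
  have "\<pi> = relay_policy w (\<pi> [(True, w)])"
  proof
    fix h
    show "\<pi> h = relay_policy w (\<pi> [(True, w)]) h"
      using \<pi> by (auto simp: policies_def decision_hists_relay relay_policy_def PiE_iff
          extensional_def)
  qed
  then show "\<pi> \<in> {relay_policy w True, relay_policy w False}"
    by (cases "\<pi> [(True, w)]") auto
qed (auto simp: policies_def decision_hists_relay relay_policy_def)

lemma val_relay_policy: "val (relay w z Off End) (relay_policy w c) 0 [] = lower_exp End (z c)"
  by (subst val_relay_root) (simp_all add: relay_policy_def)

text \<open>At every history but one there is nothing to choose, and at the remaining one the values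
  do not depend on the policy.\<close>

lemma pure_SPE_relay_iff:
  assumes "lower_exp Off (z (\<not> c)) < lower_exp Off (z c)"
  shows "pure_SPE (relay w z Off End) \<pi> \<longleftrightarrow> \<pi> = relay_policy w c"
proof -
  have best: "is_arg_max (\<lambda>d. lower_exp Off (z d)) (\<lambda>d. d \<in> UNIV) d \<longleftrightarrow> d = c" for d
    using assms by (cases c; cases d) (auto simp: is_arg_max_def all_bool_eq not_less)
  have q: "qval (relay w z Off End) \<pi> (length [(True, w)]) [(True, w)]
      = (\<lambda>d. lower_exp Off (z d))"
    by (simp add: fun_eq_iff qval_relay_date_1)
  show ?thesis
  proof
    assume "pure_SPE (relay w z Off End) \<pi>"
    then have \<pi>: "\<pi> \<in> {relay_policy w True, relay_policy w False}"
      and "is_arg_max (qval (relay w z Off End) \<pi> (length [(True, w)]) [(True, w)])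
             (\<lambda>d. d \<in> act (relay w z Off End) [(True, w)]) (\<pi> [(True, w)])"
      by (auto simp: pure_SPE_def policies_relay decision_hists_relay)
    then have "\<pi> [(True, w)] = c"
      using best by (simp only: q relay_sel simp_thms if_True)
    with \<pi> show "\<pi> = relay_policy w c"
      by auto
  next
    assume \<pi>: "\<pi> = relay_policy w c"
    have "is_arg_max (qval (relay w z Off End) \<pi> (length h) h)
            (\<lambda>d. d \<in> act (relay w z Off End) h) (\<pi> h)"
      if h: "h \<in> decision_hists (relay w z Off End)" for h
    proof (cases "h = [(True, w)]")
      case True
      have "\<pi> [(True, w)] = c"
        using \<pi> by simp
      then show ?thesis
        using best[of c] by (simp only: True q relay_sel simp_thms if_True)
    next
      case False
      then show ?thesis
        using h \<pi> by (auto simp: is_arg_max_def decision_hists_relay relay_policy_def)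
    qed
    then show "pure_SPE (relay w z Off End) \<pi>"
      using \<pi> by (cases c) (auto simp: pure_SPE_def policies_relay)
  qed
qed

lemma ex1_pure_SPE_relay:
  assumes "lower_exp Off (z (\<not> c)) < lower_exp Off (z c)"
  shows "\<exists>!\<pi>. pure_SPE (relay w z Off End) \<pi>"
  using pure_SPE_relay_iff[OF assms] by auto

lemma the_SPE_relay:
  assumes "lower_exp Off (z (\<not> c)) < lower_exp Off (z c)"
  shows "the_SPE (relay w z Off End) = relay_policy w c"
  unfolding the_SPE_def using pure_SPE_relay_iff[OF assms] by (intro the_equality) auto

lemma PoR_relay:
  assumes "lower_exp Off (z (\<not> c)) < lower_exp Off (z c)"
  shows "PoR\<^sub>0 (relay w z Off End) =
    max (lower_exp End (z True)) (lower_exp End (z False)) - lower_exp End (z c)"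
  by (simp add: PoR\<^sub>0_def the_SPE_relay[OF assms] policies_relay val_relay_policy)

lemma PoR_relay_disagree:
  assumes "lower_exp Off (z True) < lower_exp Off (z False)"
    and "lower_exp End (z False) < lower_exp End (z True)"
  shows "PoR\<^sub>0 (relay w z Off End) = lower_exp End (z True) - lower_exp End (z False)"
  using PoR_relay[of Off z False w End] assms by simp

lemma PoR_relay_agree:
  assumes "lower_exp End (z False) < lower_exp End (z True)"
  shows "PoR\<^sub>0 (relay w z End End) = 0"
  using PoR_relay[of End z True w End] assms by simp

lemma strictly_prefers_relay_iff:
  "strictly_prefers (relay w z Off End) \<pi> s [(True, w)] c \<longleftrightarrow>
     lower_exp (if s = 1 then Off else End) (z (\<not> c))
       < lower_exp (if s = 1 then Off else End) (z c)"
  by (cases c) (auto simp: strictly_prefers_def qval_relay_date_1 UNIV_bool)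

lemma action_gap_relay:
  "action_gap (relay w z Off End) \<pi> s [(True, w)] =
     \<bar>lower_exp (if s = 1 then Off else End) (z True)
       - lower_exp (if s = 1 then Off else End) (z False)\<bar>"
  by (auto simp: action_gap_def qval_relay_date_1 UNIV_bool max_def min_def)

lemma decision_equivalent_across_vintages_relay:
  "decision_equivalent_across_vintages (relay w z End End)"
  by (simp add: decision_equivalent_across_vintages_def decision_equivalent_def)

lemma rewards_bounded_by_relay:
  assumes "\<And>c. infnorm (z c) \<le> 1"
  shows "rewards_bounded_by 1 (relay w z Off End)"
proof -
  have "\<bar>z c $ y\<bar> \<le> 1" for c y
    using component_le_infnorm_cart[of "z c" y] assms[of c] by linarith
  then show ?thesis
    by (auto simp: rewards_bounded_by_def hists_relay)
qed

lemma two_action_three_date_relay: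
  "two_action_three_date (relay w z Off End) [(True, w)] True False"
  unfolding two_action_three_date_def hists_relay by (auto simp: UNIV_bool)

lemma uses_evaluators_relay: "uses_evaluators (relay w z Off End) Off End"
  unfolding uses_evaluators_def hists_relay by auto

lemma has_payoff_vectors_relay: "has_payoff_vectors (relay w z Off End) z"
  unfolding has_payoff_vectors_def hists_relay by auto

text \<open>The tree and its own collapse share the endpoint data, but only one of them has a
  positive price.\<close>

lemma endpoint_insufficient_relay:
  assumes Off: "ambiguity_set Off" and End: "ambiguity_set End"
    and prefs: "lower_exp Off (z True) < lower_exp Off (z False)"
      "lower_exp End (z False) < lower_exp End (z True)"
  shows "endpoint_insufficient (relay w z Off End)"
  unfolding endpoint_insufficient_def
proof (intro conjI exI)
  show "finite_kernel_system (relay w z Off End)" "finite_kernel_system (relay w z End End)"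
    by (rule finite_kernel_system_relay; fact)+
  show "\<exists>!\<pi>. pure_SPE (relay w z Off End) \<pi>"
    using prefs by (intro ex1_pure_SPE_relay[where c = False]) simp
  show "\<exists>!\<pi>. pure_SPE (relay w z End End) \<pi>"
    using prefs by (intro ex1_pure_SPE_relay[where c = True]) simp
  show "same_endpoint_data (relay w z Off End) (relay w z End End)"
    by (auto simp: same_endpoint_data_def relay_def)
  show "PoR\<^sub>0 (relay w z End End) \<noteq> PoR\<^sub>0 (relay w z Off End)"
    using prefs by (simp add: PoR_relay_disagree PoR_relay_agree)
qed


section \<open>Openness of strict disagreement\<close>

text \<open>The radius in the definition of openness does not depend on the perturbed payoffs: the
  bound on the change of a value involves the payoff vectors of the centre only.\<close>

lemma perturbation_open_gaps:
  fixes \<alpha> \<beta> :: real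
  shows "perturbation_open
    {(z :: bool \<Rightarrow> real ^ 'n, Off, End). ambiguity_set Off \<and> ambiguity_set End \<and>
       \<alpha> < lower_exp End (z True) - lower_exp End (z False) \<and>
       \<beta> < lower_exp Off (z False) - lower_exp Off (z True)}" (is "perturbation_open ?U")
  unfolding perturbation_open_def
proof (intro conjI ballI)
  show "?U \<subseteq> perturbation_space"
    by (auto simp: perturbation_space_def)
  fix x assume "x \<in> ?U"
  then obtain z Off End where x: "x = (z, Off, End)"
    and Off: "ambiguity_set Off" and End: "ambiguity_set End"
    and gaps: "\<alpha> < lower_exp End (z True) - lower_exp End (z False)"
      "\<beta> < lower_exp Off (z False) - lower_exp Off (z True)"
    by auto
  define M where "M = 1 + infnorm (z True) + infnorm (z False)"
  define slack where "slack = min (lower_exp End (z True) - lower_exp End (z False) - \<alpha>)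
    (lower_exp Off (z False) - lower_exp Off (z True) - \<beta>)"
  have M: "0 < M" "1 + infnorm (z c) \<le> M" for c
    using infnorm_pos_le[of "z True"] infnorm_pos_le[of "z False"]
    by (cases c; simp add: M_def)+
  \<comment> \<open>Each value then moves by at most \<open>r * M\<close>, half of the slack, and a gap has two values.\<close>
  define r where "r = slack / (2 * M)"
  have "0 < slack"
    using gaps by (simp add: slack_def)
  then have "0 < r" and rM: "2 * (r * M) = slack"
    using M(1) by (simp_all add: r_def)
  have "(z', Off', End') \<in> ?U"
    if Off': "ambiguity_set Off'" and End': "ambiguity_set End'"
      and close: "\<And>c. infnorm (z' c - z c) < r" "D_op Off' Off < r" "D_op End' End < r"
    for z' Off' End'
  proof -
    have moved: "\<bar>lower_exp E' (z' c) - lower_exp E (z c)\<bar> < r * M"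
      if "ambiguity_set E" "ambiguity_set E'" "D_op E' E < r" for E E' c
    proof -
      have "\<bar>lower_exp E' (z' c) - lower_exp E (z c)\<bar>
          \<le> infnorm (z' c - z c) + D_op E' E * infnorm (z c)"
        using that by (intro lower_exp_perturbation_le)
      also have "\<dots> < r + r * infnorm (z c)"
        using that close(1)[of c] infnorm_pos_le[of "z c"]
        by (intro add_less_le_mono mult_right_mono) auto
      also have "\<dots> \<le> r * M"
        using \<open>0 < r\<close> M(2)[of c] mult_left_mono[of "1 + infnorm (z c)" M r]
        by (simp add: algebra_simps)
      finally show ?thesis .
    qed
    have "slack \<le> lower_exp End (z True) - lower_exp End (z False) - \<alpha>"
      "slack \<le> lower_exp Off (z False) - lower_exp Off (z True) - \<beta>"
      by (simp_all add: slack_def)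
    with moved[OF End End' close(3), of True] moved[OF End End' close(3), of False]
      moved[OF Off Off' close(2), of True] moved[OF Off Off' close(2), of False] rM
    have "\<alpha> < lower_exp End' (z' True) - lower_exp End' (z' False)"
      "\<beta> < lower_exp Off' (z' False) - lower_exp Off' (z' True)"
      by linarith+
    with Off' End' show ?thesis
      by simp
  qed
  with \<open>0 < r\<close> show "case x of (z, Off, End) \<Rightarrow> \<exists>r>0. \<forall>(z', Off', End')\<in>perturbation_space.
      (\<forall>a. infnorm (z' a - z a) < r) \<and> D_op Off' Off < r \<and> D_op End' End < r
        \<longrightarrow> (z', Off', End') \<in> ?U"
    unfolding x perturbation_space_def by (auto intro!: exI[of _ r])
qed


section \<open>Endpoint insufficiency\<close>

theorem theorem7p4:
  fixes A B Off End :: "(real ^ 'n) set" and \<delta> \<xi> :: real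
  assumes "ambiguity_set A" and "ambiguity_set B"
    and "\<delta> = D_op A B" and "\<delta> > 0"
    and "0 < \<xi>" and "\<xi> < \<delta>"
    and roles: "(Off = A \<and> End = B) \<or> (Off = B \<and> End = A)"
  shows "\<exists>(S :: (bool, 'n) kernel_system) h a b z g.
    finite_kernel_system S \<and> rewards_bounded_by 1 S \<and> two_action_three_date S h a b \<and>
    uses_evaluators S Off End \<and> has_payoff_vectors S z \<and>
    (\<forall>c\<in>{a, b}. qval S (the_SPE S) 0 h c = lower_exp End (z c) \<and>
                qval S (the_SPE S) 1 h c = lower_exp Off (z c)) \<and>
    (\<exists>!\<pi>. pure_SPE S \<pi>) \<and> (\<exists>!\<pi>. pure_SPE (endpoint_collapse S) \<pi>) \<and>
    PoR\<^sub>0 S \<ge> g \<and> g > (\<delta> - \<xi>) / 2 \<and> PoR\<^sub>0 (endpoint_collapse S) = 0 \<and>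
    action_gap S (the_SPE S) 0 h = g \<and> action_gap S (the_SPE S) 1 h = g \<and>
    strictly_prefers S (the_SPE S) 0 h a \<and> strictly_prefers S (the_SPE S) 1 h b \<and>
    decision_equivalent_across_vintages (endpoint_collapse S) \<and>
    (\<forall>z' Off' End' \<omega>.
       ambiguity_set Off' \<and> ambiguity_set End' \<and>
       (\<forall>c\<in>{a, b}. \<bar>lower_exp Off' (z' c) - lower_exp Off (z c)\<bar> \<le> \<omega> \<and>
                   \<bar>lower_exp End' (z' c) - lower_exp End (z c)\<bar> \<le> \<omega>) \<and>
       2 * \<omega> < g \<longrightarrow>
       (let S' = perturb S z' Off' End' in
          finite_kernel_system S' \<and>
          (\<exists>!\<pi>. pure_SPE S' \<pi>) \<and> (\<exists>!\<pi>. pure_SPE (endpoint_collapse S') \<pi>) \<and>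
          strictly_prefers S' (the_SPE S') 0 h a \<and> strictly_prefers S' (the_SPE S') 1 h b \<and>
          decision_equivalent_across_vintages (endpoint_collapse S') \<and>
          PoR\<^sub>0 S' - PoR\<^sub>0 (endpoint_collapse S') \<ge> g - 2 * \<omega> \<and> g - 2 * \<omega> > 0)) \<and>
    (\<forall>z' Off' End' \<epsilon> \<kappa>.
       ambiguity_set Off' \<and> ambiguity_set End' \<and>
       (\<forall>c\<in>{a, b}. infnorm (z' c - z c) \<le> \<epsilon>) \<and>
       D_op Off' Off \<le> \<kappa> \<and> D_op End' End \<le> \<kappa> \<longrightarrow>
       (\<forall>c\<in>{a, b}. \<bar>lower_exp Off' (z' c) - lower_exp Off (z c)\<bar> \<le> \<epsilon> + \<kappa> \<and>
                   \<bar>lower_exp End' (z' c) - lower_exp End (z c)\<bar> \<le> \<epsilon> + \<kappa>)) \<and>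
    (\<exists>U. perturbation_open U \<and> (z, Off, End) \<in> U \<and>
       (\<forall>(z', Off', End')\<in>U.
          endpoint_insufficient (perturb S z' Off' End') \<and>
          PoR\<^sub>0 (perturb S z' Off' End') - PoR\<^sub>0 (endpoint_collapse (perturb S z' Off' End'))
            > (\<delta> - \<xi>) / 2))"
proof -
  have Off: "ambiguity_set Off" and End: "ambiguity_set End"
    and D: "D_op Off End = \<delta>"
    using roles assms(1-3) D_op_commute[of A B] by auto
  have "\<delta> - \<xi> < D_op Off End"
    using D \<open>0 < \<xi>\<close> by simp
  from halfway_payoffs[OF Off End this] obtain z :: "bool \<Rightarrow> real ^ 'n" and g where
    z: "\<And>c. infnorm (z c) \<le> 1" and g: "(\<delta> - \<xi>) / 2 < g"
    and gapE: "lower_exp End (z True) - lower_exp End (z False) = g"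
    and gapO: "lower_exp Off (z False) - lower_exp Off (z True) = g"
    by blast
  have "0 < g"
    using g \<open>\<xi> < \<delta>\<close> by simp
  then have prefs: "lower_exp Off (z True) < lower_exp Off (z False)"
      "lower_exp End (z False) < lower_exp End (z True)"
    using gapE gapO by simp_all
  fix w :: 'n
  define S where "S = relay w z Off End"
  have perturb: "perturb S z' Off' End' = relay w z' Off' End'" for z' Off' End'
    by (simp add: S_def perturb_relay)
  have SPE: "\<exists>!\<pi>. pure_SPE (relay w z' Off' E) \<pi>"
      "\<exists>!\<pi>. pure_SPE (endpoint_collapse (relay w z' Off' End')) \<pi>"
    if "lower_exp Off' (z' True) < lower_exp Off' (z' False)"
      "lower_exp End' (z' False) < lower_exp End' (z' True)" for z' Off' End' E
    using that ex1_pure_SPE_relay[of Off' z' False] ex1_pure_SPE_relay[of End' z' True]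
    by (simp_all add: endpoint_collapse_relay)
  have robust: "let S' = perturb S z' Off' End' in
          finite_kernel_system S' \<and>
          (\<exists>!\<pi>. pure_SPE S' \<pi>) \<and> (\<exists>!\<pi>. pure_SPE (endpoint_collapse S') \<pi>) \<and>
          strictly_prefers S' (the_SPE S') 0 [(True, w)] True \<and>
          strictly_prefers S' (the_SPE S') 1 [(True, w)] False \<and>
          decision_equivalent_across_vintages (endpoint_collapse S') \<and>
          PoR\<^sub>0 S' - PoR\<^sub>0 (endpoint_collapse S') \<ge> g - 2 * \<omega> \<and> g - 2 * \<omega> > 0"
    if amb: "ambiguity_set Off'" "ambiguity_set End'"
      and moved: "\<forall>c\<in>{True, False}. \<bar>lower_exp Off' (z' c) - lower_exp Off (z c)\<bar> \<le> \<omega> \<and>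
                   \<bar>lower_exp End' (z' c) - lower_exp End (z c)\<bar> \<le> \<omega>"
      and small: "2 * \<omega> < g"
    for z' Off' End' \<omega>
  proof -
    have gaps: "g - 2 * \<omega> \<le> lower_exp Off' (z' False) - lower_exp Off' (z' True)"
        "g - 2 * \<omega> \<le> lower_exp End' (z' True) - lower_exp End' (z' False)"
      using moved gapE gapO by (auto simp: abs_le_iff)
    then have prefs': "lower_exp Off' (z' True) < lower_exp Off' (z' False)"
        "lower_exp End' (z' False) < lower_exp End' (z' True)"
      using small by linarith+
    show ?thesis
      unfolding Let_def perturb
      using SPE[of Off' z' End'] finite_kernel_system_relay[OF amb] prefs' gaps(2) small
      by (simp add: strictly_prefers_relay_iff decision_equivalent_across_vintages_relay
          endpoint_collapse_relay PoR_relay_disagree PoR_relay_agree)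
  qed
  have moved: "\<bar>lower_exp E' (z' c) - lower_exp E (z c)\<bar> \<le> \<epsilon> + \<kappa>"
    if "ambiguity_set E" "ambiguity_set E'" "infnorm (z' c - z c) \<le> \<epsilon>" "D_op E' E \<le> \<kappa>"
    for E E' z' c \<epsilon> \<kappa>
    using lower_exp_perturbation_le[OF that(1,2), of "z' c" "z c"] that(3,4)
      mult_left_mono[OF z[of c] D_op_nonneg[OF that(2,1)]] by simp
  define U where "U = {(z' :: bool \<Rightarrow> real ^ 'n, Off', End').
    ambiguity_set Off' \<and> ambiguity_set End' \<and>
    (\<delta> - \<xi>) / 2 < lower_exp End' (z' True) - lower_exp End' (z' False) \<and>
    0 < lower_exp Off' (z' False) - lower_exp Off' (z' True)}"
  have openU: "perturbation_open U"
    unfolding U_def by (rule perturbation_open_gaps)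
  have inU: "(z, Off, End) \<in> U"
    using Off End prefs gapE g by (simp add: U_def)
  have insufficientU: "\<forall>(z', Off', End')\<in>U.
      endpoint_insufficient (perturb S z' Off' End') \<and>
      PoR\<^sub>0 (perturb S z' Off' End') - PoR\<^sub>0 (endpoint_collapse (perturb S z' Off' End'))
        > (\<delta> - \<xi>) / 2"
  proof clarify
    fix z' Off' End' assume "(z', Off', End') \<in> U"
    then have amb: "ambiguity_set Off'" "ambiguity_set End'"
      and gap: "(\<delta> - \<xi>) / 2 < lower_exp End' (z' True) - lower_exp End' (z' False)"
      and prefs': "lower_exp Off' (z' True) < lower_exp Off' (z' False)"
        "lower_exp End' (z' False) < lower_exp End' (z' True)"
      using \<open>\<xi> < \<delta>\<close> by (auto simp: U_def)
    then show "endpoint_insufficient (perturb S z' Off' End') \<and>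
      PoR\<^sub>0 (perturb S z' Off' End') - PoR\<^sub>0 (endpoint_collapse (perturb S z' Off' End'))
        > (\<delta> - \<xi>) / 2"
      by (simp add: perturb endpoint_insufficient_relay endpoint_collapse_relay
          PoR_relay_disagree PoR_relay_agree)
  qed
  show ?thesis
  proof (rule exI[of _ S], rule exI[of _ "[(True, w)]"], rule exI[of _ True],
      rule exI[of _ False], rule exI[of _ z], rule exI[of _ g], intro conjI)
    show "finite_kernel_system S" "rewards_bounded_by 1 S"
      "two_action_three_date S [(True, w)] True False"
      "uses_evaluators S Off End" "has_payoff_vectors S z"
      unfolding S_def using Off End z
      by (simp_all add: finite_kernel_system_relay rewards_bounded_by_relay
          two_action_three_date_relay uses_evaluators_relay has_payoff_vectors_relay)
    show "\<forall>c\<in>{True, False}. qval S (the_SPE S) 0 [(True, w)] c = lower_exp End (z c) \<and>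
        qval S (the_SPE S) 1 [(True, w)] c = lower_exp Off (z c)"
      by (simp add: S_def qval_relay_date_1)
    show "\<exists>!\<pi>. pure_SPE S \<pi>" "\<exists>!\<pi>. pure_SPE (endpoint_collapse S) \<pi>"
      using SPE[OF prefs] by (simp_all add: S_def)
    show "g \<le> PoR\<^sub>0 S" "PoR\<^sub>0 (endpoint_collapse S) = 0"
      using prefs gapE
      by (simp_all add: S_def endpoint_collapse_relay PoR_relay_disagree PoR_relay_agree)
    show "(\<delta> - \<xi>) / 2 < g"
      by (fact g)
    show "action_gap S (the_SPE S) 0 [(True, w)] = g" "action_gap S (the_SPE S) 1 [(True, w)] = g"
      using gapE gapO \<open>0 < g\<close> by (simp_all add: S_def action_gap_relay abs_if)
    show "strictly_prefers S (the_SPE S) 0 [(True, w)] True"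
      "strictly_prefers S (the_SPE S) 1 [(True, w)] False"
      using prefs by (simp_all add: S_def strictly_prefers_relay_iff)
    show "decision_equivalent_across_vintages (endpoint_collapse S)"
      by (simp add: S_def endpoint_collapse_relay decision_equivalent_across_vintages_relay)
  qed (use robust moved Off End openU inU insufficientU in blast)+
qed

end
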